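(* Let $n \ge p > 0$ be integers. For all $U,\widetilde U\in \mathrm{St}(n,p)$: (a) if $0<\beta_2\le \beta_1$, then $d_{\beta_1}(U,\widetilde U)\le \sqrt{\frac{\beta_1}{\beta_2}}\, d_{\beta_2}(U,\widetilde U)$; (b) if $0<\beta_1\le \beta_2$, then $d_{\beta_1}(U,\widetilde U)\le d_{\beta_2}(U,\widetilde U)$.
   Context: The Stiefel manifold is $\mathrm{St}(n,p)=\{U\in\mathbb{R}^{n\times p} : U^TU=I_p\}$, with tangent space $T_U\mathrm{St}(n,p)=\{\Delta\in\mathbb{R}^{n\times p} : U^T\Delta+\Delta^TU=0\}$. For $\beta>0$ the $\beta$-metric is $\langle\Delta,\widetilde\Delta\rangle_\beta=\mathrm{Tr}\big(\Delta^T(I_n-(1-\beta)UU^T)\widetilde\Delta\big)$ for $\Delta,\widetilde\Delta\in T_U\mathrm{St}(n,p)$, with norm $\|\Delta\|_\beta=\sqrt{\langle\Delta,\Delta\rangle_\beta}$. The length of a continuously differentiable curve $\gamma:[0,1]\to\mathrm{St}(n,p)$ is $l_\beta(\gamma)=\int_0^1\|\dot\gamma(t)\|_\beta\,dt$, and the geodesic $\beta$-distance is $d_\beta(U,\widetilde U)=\inf\{l_\beta(\gamma) : \gamma(0)=U,\ \gamma(1)=\widetilde U\}$, the infimum being over continuously differentiable curves in $\mathrm{St}(n,p)$. When $n=p$ the manifold has two connected components, and distances are considered between points of the same component. *)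

theory Defs
  imports "HOL-Analysis.Analysis"
begin

text \<open>An \<open>n \<times> p\<close> matrix has type \<^typ>\<open>real^'p^'n\<close>, with \<open>n = CARD('n)\<close> and \<open>p = CARD('p)\<close>;
  both are positive because types are nonempty.\<close>

definition Stiefel :: "(real^'p^'n) set" where
  "Stiefel = {U. transpose U ** U = mat 1}"

text \<open>The formulas below make sense for arbitrary matrices \<open>\<Delta>\<close>, \<open>\<Delta>'\<close>. They are applied only to
  velocities of curves in the Stiefel manifold; differentiating \<open>\<gamma>\<^sup>T \<gamma> = I\<close> shows that these satisfy
  the tangency condition \<open>U\<^sup>T \<Delta> + \<Delta>\<^sup>T U = 0\<close>. For \<open>U\<close> in the manifold and \<open>\<beta> > 0\<close> the
  form is positive definite.\<close>

definition beta_metric :: "real \<Rightarrow> real^'p^'n \<Rightarrow> real^'p^'n \<Rightarrow> real^'p^'n \<Rightarrow> real" where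
  "beta_metric \<beta> U \<Delta> \<Delta>' =
     trace (transpose \<Delta> ** (mat 1 - (1 - \<beta>) *\<^sub>R (U ** transpose U)) ** \<Delta>')"

definition beta_norm :: "real \<Rightarrow> real^'p^'n \<Rightarrow> real^'p^'n \<Rightarrow> real" where
  "beta_norm \<beta> U \<Delta> = sqrt (beta_metric \<beta> U \<Delta> \<Delta>)"

text \<open>Derivatives are taken within \<open>[0,1]\<close>, hence are one-sided at the endpoints, so that the values
  of \<open>\<gamma>\<close> outside \<open>[0,1]\<close> are irrelevant. (\<^const>\<open>C1_differentiable_on\<close> uses two-sided
  derivatives.)\<close>

definition velocity :: "(real \<Rightarrow> real^'p^'n) \<Rightarrow> real \<Rightarrow> real^'p^'n" where
  "velocity \<gamma> t = vector_derivative \<gamma> (at t within {0..1})"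

definition C1_curve_in :: "(real^'p^'n) set \<Rightarrow> (real \<Rightarrow> real^'p^'n) \<Rightarrow> bool" where
  "C1_curve_in M \<gamma> \<longleftrightarrow>
     \<gamma> ` {0..1} \<subseteq> M \<and> \<gamma> differentiable_on {0..1} \<and> continuous_on {0..1} (velocity \<gamma>)"

definition beta_length :: "real \<Rightarrow> (real \<Rightarrow> real^'p^'n) \<Rightarrow> real" where
  "beta_length \<beta> \<gamma> = integral {0..1} (\<lambda>t. beta_norm \<beta> (\<gamma> t) (velocity \<gamma> t))"

text \<open>The infimum is taken in the extended reals, so the distance between points that no curve joins
  (points in different components, when \<open>n = p\<close>) is \<open>\<infinity>\<close>.\<close>

definition beta_dist :: "real \<Rightarrow> real^'p^'n \<Rightarrow> real^'p^'n \<Rightarrow> ereal" where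
  "beta_dist \<beta> U V =
     Inf {ereal (beta_length \<beta> \<gamma>) | \<gamma>. C1_curve_in Stiefel \<gamma> \<and> \<gamma> 0 = U \<and> \<gamma> 1 = V}"

end

theory Submission imports Defs begin

text \<open>For \<open>U\<close> in the Stiefel manifold, split a velocity into its part in the column span of \<open>U\<close> and the
  orthogonal rest: \<open>\<parallel>\<Delta>\<parallel>\<^sub>\<beta>\<^sup>2 = \<parallel>\<Delta> - U U\<^sup>T \<Delta>\<parallel>\<^sup>2 + \<beta> \<parallel>U\<^sup>T \<Delta>\<parallel>\<^sup>2\<close>. This is nondecreasing in \<open>\<beta>\<close>, and its quotient
  by \<open>\<beta>\<close> is nonincreasing. The resulting comparison of norms holds pointwise along every curve, hence
  for lengths and for their infima.\<close>

lemma trace_transpose_mul: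
  fixes A B :: "real^'p^'n"
  shows "trace (transpose A ** B) = A \<bullet> B"
  unfolding trace_def transpose_def matrix_matrix_mult_def inner_vec_def
  by (simp add: sum.swap[of _ "UNIV :: 'p set"])

text \<open>Left multiplication by \<open>transpose A\<close> is the adjoint of left multiplication
  by \<open>A\<close> for the Frobenius inner product, which is the inner product of the type
  \<open>real^'p^'n\<close>.\<close>

lemma inner_matrix_mul_left:
  fixes A :: "real^'m^'n" and B :: "real^'p^'m" and C :: "real^'p^'n"
  shows "(A ** B) \<bullet> C = B \<bullet> (transpose A ** C)"
  by (simp flip: trace_transpose_mul add: matrix_transpose_mul matrix_mul_assoc)

lemma matrix_diff_rdistrib:
  fixes A B :: "'a::ring_1^'m^'n" and C :: "'a^'p^'m"
  shows "(A - B) ** C = A ** C - B ** C"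
  by (simp add: matrix_matrix_mult_def vec_eq_iff left_diff_distrib sum_subtractf)

lemma beta_metric_eq_inner:
  "beta_metric \<beta> U \<Delta> \<Delta>' =
     \<Delta> \<bullet> \<Delta>' - (1 - \<beta>) * ((transpose U ** \<Delta>) \<bullet> (transpose U ** \<Delta>'))"
proof -
  have "(mat 1 - (1 - \<beta>) *\<^sub>R (U ** transpose U)) ** \<Delta>'
      = \<Delta>' - (1 - \<beta>) *\<^sub>R (U ** (transpose U ** \<Delta>'))"
    by (simp add: matrix_diff_rdistrib matrix_mul_assoc flip: scalar_matrix_assoc)
  moreover have "\<Delta> \<bullet> (U ** (transpose U ** \<Delta>')) = (transpose U ** \<Delta>) \<bullet> (transpose U ** \<Delta>')"
    by (metis inner_commute inner_matrix_mul_left)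
  ultimately show ?thesis
    unfolding beta_metric_def
    by (simp flip: matrix_mul_assoc add: trace_transpose_mul inner_diff_right)
qed

text \<open>Pythagoras: \<open>U ** transpose U\<close> is the orthogonal projection onto the column
  span of \<open>U\<close>, and \<open>U\<close> preserves norms, so expanding the first square
  leaves the squared norm of \<open>\<Delta>\<close> minus that of
  \<open>transpose U ** \<Delta>\<close>.\<close>

lemma beta_metric_Stiefel:
  assumes "U \<in> Stiefel"
  shows "beta_metric \<beta> U \<Delta> \<Delta> =
    (norm (\<Delta> - U ** (transpose U ** \<Delta>)))\<^sup>2 + \<beta> * (norm (transpose U ** \<Delta>))\<^sup>2"
proof -
  let ?B = "transpose U ** \<Delta>"
  have "(U ** ?B) \<bullet> (U ** ?B) = ?B \<bullet> ?B"
    unfolding inner_matrix_mul_left[of U] using assms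
    by (simp add: matrix_mul_assoc Stiefel_def)
  moreover have "(U ** ?B) \<bullet> \<Delta> = ?B \<bullet> ?B"
    by (rule inner_matrix_mul_left)
  ultimately show ?thesis
    by (simp add: beta_metric_eq_inner power2_norm_eq_inner inner_diff_left inner_diff_right
        inner_commute algebra_simps)
qed

lemma beta_norm_mono:
  assumes "U \<in> Stiefel" "\<beta>\<^sub>1 \<le> \<beta>\<^sub>2"
  shows "beta_norm \<beta>\<^sub>1 U \<Delta> \<le> beta_norm \<beta>\<^sub>2 U \<Delta>"
  using assms by (simp add: beta_norm_def beta_metric_Stiefel mult_right_mono)

lemma beta_norm_le_sqrt_mult:
  assumes "U \<in> Stiefel" "0 < \<beta>\<^sub>2" "\<beta>\<^sub>2 \<le> \<beta>\<^sub>1"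
  shows "beta_norm \<beta>\<^sub>1 U \<Delta> \<le> sqrt (\<beta>\<^sub>1 / \<beta>\<^sub>2) * beta_norm \<beta>\<^sub>2 U \<Delta>"
proof -
  \<comment> \<open>The ratio is at least 1. This bounds the part orthogonal to the column span; the
    other part scales by exactly this ratio.\<close>
  have "a \<le> \<beta>\<^sub>1 / \<beta>\<^sub>2 * a" if "0 \<le> a" for a
    using mult_right_mono[of 1 "\<beta>\<^sub>1 / \<beta>\<^sub>2" a] that assms by simp
  then have "beta_metric \<beta>\<^sub>1 U \<Delta> \<Delta> \<le> \<beta>\<^sub>1 / \<beta>\<^sub>2 * beta_metric \<beta>\<^sub>2 U \<Delta> \<Delta>"
    using assms by (simp add: beta_metric_Stiefel distrib_left)
  then show ?thesis
    by (simp add: beta_norm_def flip: real_sqrt_mult)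
qed

lemma continuous_on_matrix_mul:
  fixes f :: "'a::topological_space \<Rightarrow> real^'m^'n" and g :: "'a \<Rightarrow> real^'p^'m"
  assumes "continuous_on S f" "continuous_on S g"
  shows "continuous_on S (\<lambda>x. f x ** g x)"
  unfolding matrix_matrix_mult_def
  by (intro continuous_intros assms)

lemma continuous_on_transpose:
  fixes f :: "'a::topological_space \<Rightarrow> real^'m^'n"
  assumes "continuous_on S f"
  shows "continuous_on S (\<lambda>x. transpose (f x))"
  unfolding transpose_def
  by (intro continuous_intros assms)

text \<open>The integrand is continuous, as \<open>sqrt\<close> is continuous on the whole real
  line. Integrability is what allows integrals to be compared pointwise.\<close>

lemma beta_norm_velocity_integrable:
  assumes "C1_curve_in M \<gamma>"
  shows "(\<lambda>t. beta_norm \<beta> (\<gamma> t) (velocity \<gamma> t)) integrable_on {0..1}"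
proof -
  have "continuous_on {0..1} \<gamma>" "continuous_on {0..1} (velocity \<gamma>)"
    using assms by (auto simp: C1_curve_in_def intro: differentiable_imp_continuous_on)
  then have "continuous_on {0..1} (\<lambda>t. beta_norm \<beta> (\<gamma> t) (velocity \<gamma> t))"
    unfolding beta_norm_def beta_metric_eq_inner
    by (intro continuous_intros continuous_on_matrix_mul continuous_on_transpose)
  then show ?thesis
    by (rule integrable_continuous_real)
qed

lemma beta_length_le_mult:
  assumes "C1_curve_in M \<gamma>"
    and "\<And>W \<Delta>. W \<in> M \<Longrightarrow> beta_norm \<beta>\<^sub>1 W \<Delta> \<le> c * beta_norm \<beta>\<^sub>2 W \<Delta>"
  shows "beta_length \<beta>\<^sub>1 \<gamma> \<le> c * beta_length \<beta>\<^sub>2 \<gamma>"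
proof -
  have "\<gamma> t \<in> M" if "t \<in> {0..1}" for t
    using assms(1) that by (auto simp: C1_curve_in_def)
  then have "integral {0..1} (\<lambda>t. beta_norm \<beta>\<^sub>1 (\<gamma> t) (velocity \<gamma> t))
      \<le> integral {0..1} (\<lambda>t. c * beta_norm \<beta>\<^sub>2 (\<gamma> t) (velocity \<gamma> t))"
    using assms
    by (intro integral_le integrable_on_mult_right beta_norm_velocity_integrable) auto
  then show ?thesis
    by (simp add: beta_length_def)
qed

text \<open>Serves both claims, with \<open>c\<close> the square root of the ratio or 1. If no curve
  joins the points, the right side is \<infinity>, because \<open>c\<close> is positive.\<close>

lemma beta_dist_le_mult:
  fixes U V :: "real^'p^'n"
  assumes "0 < c"
    and "\<And>(W :: real^'p^'n) \<Delta>. W \<in> Stiefel \<Longrightarrow> beta_norm \<beta>\<^sub>1 W \<Delta> \<le> c * beta_norm \<beta>\<^sub>2 W \<Delta>"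
  shows "beta_dist \<beta>\<^sub>1 U V \<le> ereal c * beta_dist \<beta>\<^sub>2 U V"
proof -
  \<comment> \<open>Dividing by \<open>c\<close> leaves a bare infimum on the right, so a lower
    bound for each curve suffices.\<close>
  have "beta_dist \<beta>\<^sub>1 U V / ereal c \<le> beta_dist \<beta>\<^sub>2 U V"
    unfolding beta_dist_def[of \<beta>\<^sub>2]
  proof (rule Inf_greatest, clarify)
    fix \<gamma> :: "real \<Rightarrow> real^'p^'n"
    assume \<gamma>: "C1_curve_in Stiefel \<gamma>" "U = \<gamma> 0" "V = \<gamma> 1"
    \<comment> \<open>Admissibility of a curve does not depend on \<beta>, so the same \<gamma>
      competes in both infima.\<close>
    then have "beta_dist \<beta>\<^sub>1 U V \<le> ereal (beta_length \<beta>\<^sub>1 \<gamma>)"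
      unfolding beta_dist_def by (intro Inf_lower) auto
    also have "\<dots> \<le> ereal c * ereal (beta_length \<beta>\<^sub>2 \<gamma>)"
      using beta_length_le_mult[OF \<gamma>(1) assms(2)] by simp
    finally show "beta_dist \<beta>\<^sub>1 (\<gamma> 0) (\<gamma> 1) / ereal c \<le> ereal (beta_length \<beta>\<^sub>2 \<gamma>)"
      using assms(1) \<gamma> by (subst ereal_divide_le_pos) auto
  qed
  then show ?thesis
    using assms(1) by (subst (asm) ereal_divide_le_pos) auto
qed

theorem theorem3p2:
  fixes U V :: "real^'p^'n"
  assumes "CARD('p) \<le> CARD('n)"
    and "U \<in> Stiefel" and "V \<in> Stiefel"
  shows "(\<forall>\<beta>\<^sub>1 \<beta>\<^sub>2. 0 < \<beta>\<^sub>2 \<and> \<beta>\<^sub>2 \<le> \<beta>\<^sub>1 \<longrightarrow>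
            beta_dist \<beta>\<^sub>1 U V \<le> ereal (sqrt (\<beta>\<^sub>1 / \<beta>\<^sub>2)) * beta_dist \<beta>\<^sub>2 U V) \<and>
         (\<forall>\<beta>\<^sub>1 \<beta>\<^sub>2. 0 < \<beta>\<^sub>1 \<and> \<beta>\<^sub>1 \<le> \<beta>\<^sub>2 \<longrightarrow>
            beta_dist \<beta>\<^sub>1 U V \<le> beta_dist \<beta>\<^sub>2 U V)"
proof (intro conjI allI impI)
  fix \<beta>\<^sub>1 \<beta>\<^sub>2 :: real
  assume "0 < \<beta>\<^sub>2 \<and> \<beta>\<^sub>2 \<le> \<beta>\<^sub>1"
  then show "beta_dist \<beta>\<^sub>1 U V \<le> ereal (sqrt (\<beta>\<^sub>1 / \<beta>\<^sub>2)) * beta_dist \<beta>\<^sub>2 U V"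
    by (intro beta_dist_le_mult beta_norm_le_sqrt_mult) auto
next
  fix \<beta>\<^sub>1 \<beta>\<^sub>2 :: real
  assume "0 < \<beta>\<^sub>1 \<and> \<beta>\<^sub>1 \<le> \<beta>\<^sub>2"
  then show "beta_dist \<beta>\<^sub>1 U V \<le> beta_dist \<beta>\<^sub>2 U V"
    using beta_dist_le_mult[of 1 \<beta>\<^sub>1 \<beta>\<^sub>2 U V] by (simp add: beta_norm_mono)
qed

end
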